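(* For every finite alphabet $X=\{x_1<\dots<x_p\}$, define a linear map $\alpha$ from the vector space spanned by the multiset compositions of $X$ to $\mathcal{F}(\mathbb{R}^p,\mathbb{R})$ by $$\alpha(\mathbf{A}(X))=(-1)^{l(\mathbf{A})}\,\mathbf{1}_{\mathbf{A}(X)} .$$ Then for all alphabets $X=\{x_1<\dots<x_p\}$ and $Y=\{y_1<\dots<y_q\}$ and all multiset compositions $\mathbf{A}(X)$ of $X$ and $\mathbf{B}(Y)$ of $Y$, $$\pi\bigl(\alpha(\mathbf{A}(X)),\alpha(\mathbf{B}(Y))\bigr)=\alpha\bigl(\pi(\mathbf{A}(X),\mathbf{B}(Y))\bigr).$$
   Context: A multiset composition of an alphabet $X=\{x_1<\dots<x_p\}$ is a finite sequence $\mathbf{A}(X)=A_1(X)\cdots A_r(X)$ of nonempty finite multisets of elements of $X$; $l(\mathbf{A})=r$ is its length. The alphabet $X$ is identified with the coordinate functions on $\mathbb{R}^p$. For a multiset $A$ on $X$, $s_A$ is the sum of its elements with multiplicity, a linear form on $\mathbb{R}^p$ (e.g. $s_{\{x_1,x_1,x_3,x_4,x_4,x_4\}}=2x_1+x_3+3x_4$). $\mathbf{1}_{\mathbf{A}(X)}$ is the characteristic function of the subset of $\mathbb{R}^p$ defined by $\sum_{j=1}^i s_{A_j(X)}\ge0$ for $i=1,\dots,r$ (the constant $1$ if $r=0$). Product of multiset compositions: given $\mathbf{A}(X)$ and $\mathbf{B}(Y)$, regard both as multiset compositions of the disjoint ordered union $\{x_1<\dots<x_p<y_1<\dots<y_q\}$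 (i.e. the values of $\mathbf{B}$ are shifted), with $(x_1,\dots,x_p,y_1,\dots,y_q)$ the coordinates of $\mathbb{R}^{p+q}$; then $\pi(\mathbf{A}(X),\mathbf{B}(Y))=\rho(\mathbf{A},\mathbf{B})$ is the formal sum of multiset compositions defined recursively by $\rho(\mathbf{A},\emptyset)=\mathbf{A}$, $\rho(\emptyset,\mathbf{B})=\mathbf{B}$ and, for $\mathbf{A}=\mathbf{A}'\cdot A$, $\mathbf{B}=\mathbf{B}'\cdot B$ with last parts $A$, $B$, $$\rho(\mathbf{A},\mathbf{B})=\rho(\mathbf{A},\mathbf{B}')\cdot B+\rho(\mathbf{A}',\mathbf{B})\cdot A+\rho(\mathbf{A}',\mathbf{B}')\cdot(A\cup B),$$ where $\cup$ is union of multisets with multiplicities added and $\cdot$ is concatenation of sequences, extended linearly. $\mathcal{F}(\mathbb{R}^p,\mathbb{R})$ is the space of functions $\mathbb{R}^p\to\mathbb{R}$, and for functions $f$ on $\mathbb{R}^p$, $g$ on $\mathbb{R}^q$, $\pi(f,g)(x_1,\dots,x_{p+q})=f(x_1,\dots,x_p)\,g(x_{p+1},\dots,x_{p+q})$. *)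

theory Defs
  imports
    "HOL-Library.Poly_Mapping"
    "HOL-Library.FuncSet"
    "HOL-Library.Indicator_Function"
    "HOL-Library.Multiset"
    "Jordan_Normal_Form.Matrix"
begin

text \<open>
  An alphabet \<open>x\<^sub>1 < \<dots> < x\<^sub>p\<close> is represented by its size \<open>p\<close>, the letter \<open>x\<^sub>i\<^sub>+\<^sub>1\<close> by the
  index \<open>i < p\<close>.  The space \<open>\<real>\<^sup>p\<close> is \<open>carrier_vec p\<close>, so that \<open>x\<^sub>i\<^sub>+\<^sub>1\<close>, seen as a coordinate
  function, is \<open>\<lambda>v. v $ i\<close>.
\<close>

definition multiset_compositions :: "nat \<Rightarrow> nat multiset list set" where
  "multiset_compositions p = {A. \<forall>P\<in>set A. P \<noteq> {#} \<and> set_mset P \<subseteq> {..<p}}"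

definition part_form :: "nat multiset \<Rightarrow> real vec \<Rightarrow> real" where
  "part_form P v = (\<Sum>i\<in>#P. v $ i)"

definition comp_region :: "nat \<Rightarrow> nat multiset list \<Rightarrow> real vec set" where
  "comp_region p A =
     {v \<in> carrier_vec p. \<forall>i\<in>{1..length A}. 0 \<le> (\<Sum>j<i. part_form (A ! j) v)}"

text \<open>
  Functions \<open>\<real>\<^sup>p \<rightarrow> \<real>\<close> are the elements of \<open>carrier_vec p \<rightarrow>\<^sub>E UNIV\<close>: they are made extensional, so
  that equality in HOL is equality of functions on \<open>\<real>\<^sup>p\<close>.
\<close>

definition char_fun :: "nat \<Rightarrow> nat multiset list \<Rightarrow> real vec \<Rightarrow> real" where
  "char_fun p A = (\<lambda>v\<in>carrier_vec p. indicator (comp_region p A) v)"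

definition fun_prod ::
  "nat \<Rightarrow> nat \<Rightarrow> (real vec \<Rightarrow> real) \<Rightarrow> (real vec \<Rightarrow> real) \<Rightarrow> real vec \<Rightarrow> real" where
  "fun_prod p q f g = (\<lambda>v\<in>carrier_vec (p + q). f (vec_first v p) * g (vec_last v q))"

text \<open>
  The real vector space with basis the multiset compositions consists of the finitely supported
  functions \<open>c\<close>; the basis vector of \<open>A\<close> is \<open>Poly_Mapping.single A 1\<close>.
\<close>

type_synonym formal_sum = "nat multiset list \<Rightarrow>\<^sub>0 real"

definition formal_sums :: "nat \<Rightarrow> formal_sum set" where
  "formal_sums p = {c. Poly_Mapping.keys c \<subseteq> multiset_compositions p}"

definition basis :: "nat multiset list \<Rightarrow> formal_sum" where
  "basis A = Poly_Mapping.single A 1"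

definition snoc_part :: "formal_sum \<Rightarrow> nat multiset \<Rightarrow> formal_sum" where
  "snoc_part c P =
     (\<Sum>A\<in>Poly_Mapping.keys c. Poly_Mapping.single (A @ [P]) (Poly_Mapping.lookup c A))"

function rho :: "nat multiset list \<Rightarrow> nat multiset list \<Rightarrow> formal_sum" where
  "rho A B =
     (if B = [] then basis A
      else if A = [] then basis B
      else snoc_part (rho A (butlast B)) (last B)
         + snoc_part (rho (butlast A) B) (last A)
         + snoc_part (rho (butlast A) (butlast B)) (last A + last B))"
  by pat_completeness auto
termination
  by (relation "measure (\<lambda>(A, B). length A + length B)") (auto simp: neq_Nil_conv)

declare rho.simps [simp del]

text \<open>In the disjoint ordered union of the two alphabets, the letters of the second one follow the
  \<open>p\<close> letters of the first one.\<close>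

definition comp_prod :: "nat \<Rightarrow> nat multiset list \<Rightarrow> nat multiset list \<Rightarrow> formal_sum" where
  "comp_prod p A B = rho A (map (image_mset (\<lambda>i. p + i)) B)"

definition alpha :: "nat \<Rightarrow> formal_sum \<Rightarrow> real vec \<Rightarrow> real" where
  "alpha p c =
     (\<lambda>v\<in>carrier_vec p.
        \<Sum>A\<in>Poly_Mapping.keys c. Poly_Mapping.lookup c A * ((-1) ^ length A * char_fun p A v))"

text \<open>The recursion and the characterisation of \<open>alpha\<close> as a linear map, in their usual form.\<close>

lemma rho_Nil_right: "rho A [] = basis A"
  and rho_Nil_left: "rho [] B = basis B"
  and rho_snoc:
    "rho (A @ [P]) (B @ [Q]) =
       snoc_part (rho (A @ [P]) B) Q + snoc_part (rho A (B @ [Q])) P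
       + snoc_part (rho A B) (P + Q)"
  by (subst rho.simps; simp)+

lemma alpha_basis: "alpha p (basis A) = (\<lambda>v\<in>carrier_vec p. (-1) ^ length A * char_fun p A v)"
  by (simp add: alpha_def basis_def)

lemma alpha_superset:
  assumes "finite S" "Poly_Mapping.keys c \<subseteq> S" "v \<in> carrier_vec p"
  shows "alpha p c v =
    (\<Sum>A\<in>S. Poly_Mapping.lookup c A * ((-1) ^ length A * char_fun p A v))"
proof -
  have "(\<Sum>A\<in>Poly_Mapping.keys c. Poly_Mapping.lookup c A * ((-1) ^ length A * char_fun p A v))
      = (\<Sum>A\<in>S. Poly_Mapping.lookup c A * ((-1) ^ length A * char_fun p A v))"
    using assms(1,2) by (intro sum.mono_neutral_left) (auto simp: in_keys_iff)
  with assms(3) show ?thesis by (simp add: alpha_def)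
qed

lemma alpha_add: "alpha p (c + d) = (\<lambda>v\<in>carrier_vec p. alpha p c v + alpha p d v)"
proof
  fix v
  let ?S = "Poly_Mapping.keys c \<union> Poly_Mapping.keys d"
  show "alpha p (c + d) v = (\<lambda>v\<in>carrier_vec p. alpha p c v + alpha p d v) v"
  proof (cases "v \<in> carrier_vec p")
    case True
    have "Poly_Mapping.keys (c + d) \<subseteq> ?S" by (rule Poly_Mapping.keys_add)
    with True show ?thesis
      by (simp add: alpha_superset [of ?S] lookup_add distrib_right sum.distrib)
  qed (simp add: alpha_def)
qed

lemma alpha_scale:
  "alpha p (Poly_Mapping.map (\<lambda>x. r * x) c) = (\<lambda>v\<in>carrier_vec p. r * alpha p c v)"
proof
  fix v
  let ?c = "Poly_Mapping.map (\<lambda>x. r * x) c" and ?S = "Poly_Mapping.keys c"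
  have l: "Poly_Mapping.lookup ?c A = r * Poly_Mapping.lookup c A" for A
    by (simp add: Poly_Mapping.map.rep_eq when_def)
  show "alpha p ?c v = (\<lambda>v\<in>carrier_vec p. r * alpha p c v) v"
  proof (cases "v \<in> carrier_vec p")
    case True
    have "Poly_Mapping.keys ?c \<subseteq> ?S" by (auto simp: in_keys_iff l)
    with True show ?thesis
      by (simp add: alpha_superset [of ?S] l sum_distrib_left mult.assoc)
  qed (simp add: alpha_def)
qed

lemma formal_sums_add:
  assumes "c \<in> formal_sums p" "d \<in> formal_sums p"
  shows "c + d \<in> formal_sums p"
  using assms Poly_Mapping.keys_add [of c d] unfolding formal_sums_def by blast

lemma snoc_part_formal_sums:
  assumes "c \<in> formal_sums p" "P \<noteq> {#}" "set_mset P \<subseteq> {..<p}"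
  shows "snoc_part c P \<in> formal_sums p"
proof -
  have "Poly_Mapping.keys (snoc_part c P) \<subseteq> (\<lambda>A. A @ [P]) ` Poly_Mapping.keys c"
    unfolding snoc_part_def
    by (rule order_trans [OF keys_sum]) auto
  moreover have "A @ [P] \<in> multiset_compositions p" if "A \<in> Poly_Mapping.keys c" for A
    using assms that by (auto simp: formal_sums_def multiset_compositions_def)
  ultimately show ?thesis
    by (auto simp: formal_sums_def)
qed

lemma rho_formal_sums:
  "A \<in> multiset_compositions p \<Longrightarrow> B \<in> multiset_compositions p \<Longrightarrow> rho A B \<in> formal_sums p"
proof (induction "length A + length B" arbitrary: A B rule: less_induct)
  case less
  show ?case
  proof (cases "A = [] \<or> B = []")
    case True
    with less.prems show ?thesis
      by (auto simp: rho_Nil_left rho_Nil_right basis_def formal_sums_def)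
  next
    case False
    then obtain A' P B' Q where AB: "A = A' @ [P]" "B = B' @ [Q]"
      by (metis rev_exhaust)
    have mem: "A' \<in> multiset_compositions p" "B' \<in> multiset_compositions p"
      and PQ: "P \<noteq> {#}" "set_mset P \<subseteq> {..<p}" "Q \<noteq> {#}" "set_mset Q \<subseteq> {..<p}"
      using less.prems by (auto simp: AB multiset_compositions_def)
    have "snoc_part (rho A B') Q \<in> formal_sums p" "snoc_part (rho A' B) P \<in> formal_sums p"
      "snoc_part (rho A' B') (P + Q) \<in> formal_sums p"
      using less mem PQ by (auto intro!: snoc_part_formal_sums simp: AB)
    then show ?thesis
      unfolding AB rho_snoc by (intro formal_sums_add)
  qed
qed

lemma comp_prod_formal_sums:
  assumes "A \<in> multiset_compositions p" "B \<in> multiset_compositions q"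
  shows "comp_prod p A B \<in> formal_sums (p + q)"
proof -
  have "A \<in> multiset_compositions (p + q)"
    using assms(1) unfolding multiset_compositions_def by force
  moreover have "map (image_mset (\<lambda>i. p + i)) B \<in> multiset_compositions (p + q)"
    using assms(2) unfolding multiset_compositions_def
    by (auto dest!: bspec simp: subset_eq)
  ultimately show ?thesis
    unfolding comp_prod_def by (rule rho_formal_sums)
qed

end

theory Submission
  imports Defs
begin

text \<open>
  Both sides are evaluated at a fixed point \<open>v\<close>.  The value of \<open>alpha\<close> at a composition depends only
  on the real numbers that its parts take at \<open>v\<close>, and these do not change when both compositions are
  read over the joint alphabet (\<open>alpha_basis_transfer\<close>).  So it suffices that \<open>alpha n\<close> turns \<open>rho\<close>
  into the pointwise product for compositions over one alphabet (\<open>alpha_rho\<close>).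

  This goes by induction along the recursion of \<open>rho\<close>.  Appending a part multiplies the value of
  \<open>alpha\<close> at \<open>v\<close> by \<open>-1\<close> and by the indicator that the new total is nonnegative.  All terms of
  \<open>rho A B\<close> have the same total \<open>a + b\<close>, where \<open>a\<close> and \<open>b\<close> are the totals of \<open>A\<close> and \<open>B\<close>; hence
  the three summands of the recursion acquire the same factor \<open>- [a + b \<ge> 0]\<close>.
  After the induction hypothesis what remains is
  \<open>- [a + b \<ge> 0] * (1 - [a \<ge> 0] - [b \<ge> 0]) = [a \<ge> 0] * [b \<ge> 0]\<close>,
  which holds because \<open>a + b\<close> has the common sign when \<open>a\<close> and \<open>b\<close> are both
  nonnegative or both negative, and both sides vanish when the signs differ.
\<close>

definition total_form :: "nat multiset list \<Rightarrow> real vec \<Rightarrow> real" where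
  "total_form A v = (\<Sum>P\<leftarrow>A. part_form P v)"

lemma total_form_simps [simp]:
  "total_form [] v = 0"
  "total_form (A @ B) v = total_form A v + total_form B v"
  "total_form [P] v = part_form P v"
  by (simp_all add: total_form_def)

lemma comp_region_iff_take:
  "v \<in> comp_region n A \<longleftrightarrow>
    v \<in> carrier_vec n \<and> (\<forall>i\<in>{1..length A}. 0 \<le> total_form (take i A) v)"
proof -
  have "(\<Sum>j<i. part_form (A ! j) v) = total_form (take i A) v" if "i \<le> length A" for i
    using that by (simp add: total_form_def sum_list_sum_nth atLeast0LessThan)
  then show ?thesis
    by (auto simp: comp_region_def)
qed

lemma comp_region_snoc:
  "v \<in> comp_region n (A @ [P]) \<longleftrightarrow> v \<in> comp_region n A \<and> 0 \<le> total_form (A @ [P]) v"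
proof -
  have "{1..length (A @ [P])} = insert (length (A @ [P])) {1..length A}"
    by auto
  then show ?thesis
    by (auto simp: comp_region_iff_take)
qed

lemma alpha_basis_Nil: "v \<in> carrier_vec n \<Longrightarrow> alpha n (basis []) v = 1"
  by (simp add: alpha_basis char_fun_def comp_region_def)

lemma alpha_basis_snoc:
  assumes "v \<in> carrier_vec n"
  shows "alpha n (basis (A @ [P])) v
    = - of_bool (0 \<le> total_form (A @ [P]) v) * alpha n (basis A) v"
  using assms
  by (auto simp: alpha_basis char_fun_def indicator_def comp_region_snoc simp del: total_form_simps)

lemma alpha_single:
  "v \<in> carrier_vec n \<Longrightarrow> alpha n (Poly_Mapping.single A r) v = r * alpha n (basis A) v"
  by (simp add: alpha_superset [of "{A}"] basis_def)

lemma alpha_sum: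
  assumes "v \<in> carrier_vec n"
  shows "alpha n (\<Sum>i\<in>I. c i) v = (\<Sum>i\<in>I. alpha n (c i) v)"
proof (induction I rule: infinite_finite_induct)
  case (insert i I)
  with assms show ?case by (simp add: alpha_add)
qed (simp_all add: assms alpha_superset [of "{}"])

lemma alpha_expand:
  assumes "v \<in> carrier_vec n"
  shows "alpha n c v
    = (\<Sum>A\<in>Poly_Mapping.keys c. Poly_Mapping.lookup c A * alpha n (basis A) v)"
  using assms by (simp add: alpha_basis) (simp add: alpha_def)

lemma keys_snoc_part:
  "Poly_Mapping.keys (snoc_part c P) \<subseteq> (\<lambda>A. A @ [P]) ` Poly_Mapping.keys c"
  unfolding snoc_part_def by (rule order_trans [OF keys_sum]) auto

text \<open>The common total \<open>t\<close> is what allows the new inequality to be pulled out of the formal sum.\<close>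

lemma alpha_snoc_part:
  assumes v: "v \<in> carrier_vec n"
    and total: "\<And>A. A \<in> Poly_Mapping.keys c \<Longrightarrow> total_form A v = t"
  shows "alpha n (snoc_part c P) v = - of_bool (0 \<le> t + part_form P v) * alpha n c v"
proof -
  have "alpha n (snoc_part c P) v
      = (\<Sum>A\<in>Poly_Mapping.keys c. Poly_Mapping.lookup c A * alpha n (basis (A @ [P])) v)"
    by (simp add: snoc_part_def alpha_sum alpha_single v)
  also have "\<dots> = (\<Sum>A\<in>Poly_Mapping.keys c. - of_bool (0 \<le> t + part_form P v)
      * (Poly_Mapping.lookup c A * alpha n (basis A) v))"
    by (rule sum.cong) (simp_all add: alpha_basis_snoc v total)
  also have "\<dots> = - of_bool (0 \<le> t + part_form P v) * alpha n c v"
    by (simp only: alpha_expand [OF v, of c] sum_distrib_left)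
  finally show ?thesis .
qed

lemma part_form_add: "part_form (P + Q) v = part_form P v + part_form Q v"
  by (simp add: part_form_def)

text \<open>The induction that follows the recursion of \<open>rho\<close>, with last parts split off as in
  \<open>rho_snoc\<close>.\<close>

lemma rho_snoc_induct [case_names Nil_left Nil_right snoc]:
  assumes "\<And>B. R [] B" "\<And>A. R A []"
    and "\<And>A P B Q. R (A @ [P]) B \<Longrightarrow> R A (B @ [Q]) \<Longrightarrow> R A B \<Longrightarrow> R (A @ [P]) (B @ [Q])"
  shows "R A B"
proof (induction A arbitrary: B rule: rev_induct)
  case (snoc P A)
  show ?case
    by (induction B rule: rev_induct) (auto intro: assms snoc)
qed (rule assms(1))

text \<open>Every term of \<open>rho A B\<close> distributes exactly the letters of \<open>A\<close> and \<open>B\<close> over its parts.\<close>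

lemma total_form_rho:
  "C \<in> Poly_Mapping.keys (rho A B) \<Longrightarrow> total_form C v = total_form A v + total_form B v"
proof (induction A B arbitrary: C rule: rho_snoc_induct)
  case (snoc A P B Q)
  let ?x = "snoc_part (rho (A @ [P]) B) Q" and ?y = "snoc_part (rho A (B @ [Q])) P"
    and ?z = "snoc_part (rho A B) (P + Q)"
  have "Poly_Mapping.keys (?x + ?y + ?z)
      \<subseteq> Poly_Mapping.keys ?x \<union> Poly_Mapping.keys ?y \<union> Poly_Mapping.keys ?z"
    by (rule order_trans [OF keys_add Un_mono [OF keys_add subset_refl]])
  with snoc.prems have "C \<in> Poly_Mapping.keys ?x \<union> Poly_Mapping.keys ?y \<union> Poly_Mapping.keys ?z"
    by (auto simp: rho_snoc)
  then consider
      D where "D \<in> Poly_Mapping.keys (rho (A @ [P]) B)" "C = D @ [Q]"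
    | D where "D \<in> Poly_Mapping.keys (rho A (B @ [Q]))" "C = D @ [P]"
    | D where "D \<in> Poly_Mapping.keys (rho A B)" "C = D @ [P + Q]"
    using keys_snoc_part [of "rho (A @ [P]) B" Q] keys_snoc_part [of "rho A (B @ [Q])" P]
      keys_snoc_part [of "rho A B" "P + Q"] by blast
  then show ?case
  proof cases
    case 1
    show ?thesis by (simp add: 1(2) snoc.IH(1) [OF 1(1)])
  next
    case 2
    show ?thesis by (simp add: 2(2) snoc.IH(2) [OF 2(1)])
  next
    case 3
    show ?thesis by (simp add: 3(2) snoc.IH(3) [OF 3(1)] part_form_add)
  qed
qed (simp_all add: rho_Nil_left rho_Nil_right basis_def)

lemma alpha_rho:
  assumes v: "v \<in> carrier_vec n"
  shows "alpha n (rho A B) v = alpha n (basis A) v * alpha n (basis B) v"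
proof (induction A B rule: rho_snoc_induct)
  case (snoc A P B Q)
  let ?a = "total_form (A @ [P]) v" and ?b = "total_form (B @ [Q]) v"
  let ?f = "alpha n (basis A) v" and ?g = "alpha n (basis B) v"
  let ?s = "of_bool (0 \<le> ?a + ?b) :: real"
  have snoc_rho: "alpha n (snoc_part (rho C D) R) v
      = - of_bool (0 \<le> total_form C v + total_form D v + part_form R v) * alpha n (rho C D) v"
    for C D R
    by (rule alpha_snoc_part [OF v total_form_rho])
  have totals:
    "total_form (A @ [P]) v + total_form B v + part_form Q v = ?a + ?b"
    "total_form A v + total_form (B @ [Q]) v + part_form P v = ?a + ?b"
    "total_form A v + total_form B v + part_form (P + Q) v = ?a + ?b"
    by (simp_all add: part_form_add)
  have "alpha n (rho (A @ [P]) (B @ [Q])) v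
      = - ?s * (alpha n (rho (A @ [P]) B) v + alpha n (rho A (B @ [Q])) v + alpha n (rho A B) v)"
    by (simp add: rho_snoc alpha_add v snoc_rho totals distrib_left del: total_form_simps)
  also have "\<dots> = - ?s * (1 - of_bool (0 \<le> ?a) - of_bool (0 \<le> ?b)) * (?f * ?g)"
    unfolding snoc.IH alpha_basis_snoc [OF v] by (simp only: algebra_simps)
  also have "- ?s * (1 - of_bool (0 \<le> ?a) - of_bool (0 \<le> ?b))
      = of_bool (0 \<le> ?a) * of_bool (0 \<le> ?b)"
    by (auto simp: of_bool_def simp del: total_form_simps)
  finally show ?case
    by (simp add: alpha_basis_snoc v del: total_form_simps)
qed (simp_all add: rho_Nil_left rho_Nil_right alpha_basis_Nil v)

lemma alpha_basis_transfer:
  assumes "v \<in> carrier_vec n" "w \<in> carrier_vec m"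
    and "\<And>P. P \<in> set A \<Longrightarrow> part_form (f P) w = part_form P v"
  shows "alpha m (basis (map f A)) w = alpha n (basis A) v"
proof -
  have "(\<Sum>j<i. part_form (map f A ! j) w) = (\<Sum>j<i. part_form (A ! j) v)"
    if "i \<le> length A" for i
    using that by (intro sum.cong) (auto simp: assms(3))
  then have "w \<in> comp_region m (map f A) \<longleftrightarrow> v \<in> comp_region n A"
    using assms(1,2) by (auto simp: comp_region_def)
  then show ?thesis
    using assms(1,2) by (simp add: alpha_basis char_fun_def indicator_def)
qed

lemma part_form_vec_first:
  assumes "set_mset P \<subseteq> {..<p}"
  shows "part_form P (vec_first v p) = part_form P v"
  unfolding part_form_def
  by (rule arg_cong [where f = sum_mset], rule image_mset_cong)
    (use assms in \<open>auto simp: vec_first_def\<close>)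

lemma part_form_vec_last:
  assumes "v \<in> carrier_vec (p + q)" "set_mset P \<subseteq> {..<q}"
  shows "part_form (image_mset (\<lambda>i. p + i) P) v = part_form P (vec_last v q)"
  unfolding part_form_def multiset.map_comp
  by (rule arg_cong [where f = sum_mset], rule image_mset_cong)
    (use assms in \<open>auto simp: vec_last_def\<close>)

theorem theorem8p1:
  fixes p q :: nat and A B :: "nat multiset list"
  assumes "A \<in> multiset_compositions p" and "B \<in> multiset_compositions q"
  shows "fun_prod p q (alpha p (basis A)) (alpha q (basis B)) = alpha (p + q) (comp_prod p A B)"
proof
  fix v :: "real vec"
  show "fun_prod p q (alpha p (basis A)) (alpha q (basis B)) v
      = alpha (p + q) (comp_prod p A B) v"
  proof (cases "v \<in> carrier_vec (p + q)")
    case v: True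
    \<comment> \<open>The letters of \<open>A\<close> keep their indices: this is the transfer along the identity relabelling.\<close>
    have "alpha (p + q) (basis (map (\<lambda>P. P) A)) v = alpha p (basis A) (vec_first v p)"
      using assms(1)
      by (intro alpha_basis_transfer v) (auto simp: multiset_compositions_def part_form_vec_first)
    moreover have "alpha (p + q) (basis (map (image_mset (\<lambda>i. p + i)) B)) v
        = alpha q (basis B) (vec_last v q)"
      using assms(2) v
      by (intro alpha_basis_transfer v) (auto simp: multiset_compositions_def part_form_vec_last)
    ultimately show ?thesis
      using v by (simp add: fun_prod_def comp_prod_def alpha_rho)
  qed (simp add: fun_prod_def alpha_def)
qed

end
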